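(* Let $p$ be an odd prime, $m\ge 2$ an integer with $m\mid p-1$, $q$ a prime power with $p\mid q-1$, $\theta$ a primitive $p$-th root of unity in $\mathbb{F}_q$, and $r$ a primitive root modulo $p$. Let $A_0=\{k: 1\le k\le p-1,\ k^{(p-1)/m}\equiv1\pmod p\}$, $A_j=\{r^jk \bmod p: k\in A_0\}$ for $0\le j\le m-1$, $f_j(x)=\prod_{i\in A_j}(x-\theta^i)$, and let the $m$-th residue codes of length $p$ be the $m$ cyclic codes $\mathcal{C}_j=\langle f_j(x)\rangle\subseteq\mathbb{F}_q[x]/(x^p-1)$, $j=0,\dots,m-1$. Then: (1) there exists an LCD $m$-th residue code of length $p$ if and only if $p\equiv1\pmod{2m}$; (2) the number of LCD $m$-th residue codes of length $p$ is $0$ or $m$; (3) there exists a self-orthogonal $m$-th residue code of length $p$ if and only if $p\equiv m+1\pmod{2m}$; (4) the number of self-orthogonal $m$-th residue codes of length $p$ is $0$ or $m$.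
   Context: A linear code $\mathcal{C}$ is LCD if $\mathcal{C}\cap\mathcal{C}^\perp=\{0\}$, and (in this paper's terminology) self-orthogonal if $\mathcal{C}\cap\mathcal{C}^\perp=\mathcal{C}^\perp$, i.e. $\mathcal{C}^\perp\subseteq\mathcal{C}$, where $\perp$ is the dual for the standard inner product on $\mathbb{F}_q^p$. *)

theory Defs
  imports
    "HOL-Library.Cardinality"
    "HOL-Computational_Algebra.Polynomial"
    "HOL-Number_Theory.Prime_Powers"
    "HOL-Number_Theory.Residue_Primitive_Roots"
    "HOL-Algebra.Ideal"
    "Jordan_Normal_Form.Matrix"
begin

definition primitive_root_of_unity :: "nat \<Rightarrow> 'a::field \<Rightarrow> bool" where
  "primitive_root_of_unity n x \<longleftrightarrow>
     n > 0 \<and> x ^ n = 1 \<and> (\<forall>k. 0 < k \<and> k < n \<longrightarrow> x ^ k \<noteq> 1)"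

text \<open>The ring \<open>F[x]/(x^n - 1)\<close>, each class being represented by its unique
  representative of degree below \<open>n\<close> (for \<open>n > 0\<close>).\<close>

definition cyclic_ring :: "nat \<Rightarrow> 'a::field poly ring" where
  "cyclic_ring n =
     \<lparr>carrier = {g. degree g < n},
      mult = (\<lambda>g h. (g * h) mod (Polynomial.monom 1 n - 1)),
      one = 1 mod (Polynomial.monom 1 n - 1),
      zero = 0,
      add = (+)\<rparr>"

text \<open>The principal ideal generated by the class of \<open>g\<close>, seen in \<open>F^n\<close> by identifying
  \<open>c\<^sub>0 + c\<^sub>1 x + \<dots>\<close> with its coefficient vector \<open>(c\<^sub>0, \<dots>, c\<^bsub>n-1\<^esub>)\<close>.\<close>

definition cyclic_code :: "nat \<Rightarrow> 'a::field poly \<Rightarrow> 'a vec set" where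
  "cyclic_code n g =
     (\<lambda>c. vec n (Polynomial.coeff c)) ` (PIdl\<^bsub>cyclic_ring n\<^esub> (g mod (Polynomial.monom 1 n - 1)))"

definition dual_code :: "nat \<Rightarrow> 'a::field vec set \<Rightarrow> 'a vec set" where
  "dual_code n C = {v \<in> carrier_vec n. \<forall>c\<in>C. v \<bullet> c = 0}"

definition LCD_code :: "nat \<Rightarrow> 'a::field vec set \<Rightarrow> bool" where
  "LCD_code n C \<longleftrightarrow> C \<inter> dual_code n C = {0\<^sub>v n}"

text \<open>The dual is contained in the code, not the other way round as is more usual.\<close>

definition self_orthogonal_code :: "nat \<Rightarrow> 'a::field vec set \<Rightarrow> bool" where
  "self_orthogonal_code n C \<longleftrightarrow> C \<inter> dual_code n C = dual_code n C"

definition residue_class0 :: "nat \<Rightarrow> nat \<Rightarrow> nat set" where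
  "residue_class0 p m = {k. 1 \<le> k \<and> k \<le> p - 1 \<and> [k ^ ((p - 1) div m) = 1] (mod p)}"

definition residue_class :: "nat \<Rightarrow> nat \<Rightarrow> nat \<Rightarrow> nat \<Rightarrow> nat set" where
  "residue_class p m r j = {(r ^ j * k) mod p | k. k \<in> residue_class0 p m}"

definition residue_poly :: "nat \<Rightarrow> nat \<Rightarrow> nat \<Rightarrow> 'a::field \<Rightarrow> nat \<Rightarrow> 'a poly" where
  "residue_poly p m r \<theta> j = (\<Prod>i\<in>residue_class p m r j. [:- (\<theta> ^ i), 1:])"

definition residue_code :: "nat \<Rightarrow> nat \<Rightarrow> nat \<Rightarrow> 'a::field \<Rightarrow> nat \<Rightarrow> 'a vec set" where
  "residue_code p m r \<theta> j = cyclic_code p (residue_poly p m r \<theta> j)"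

definition residue_codes :: "nat \<Rightarrow> nat \<Rightarrow> nat \<Rightarrow> 'a::field \<Rightarrow> 'a vec set set" where
  "residue_codes p m r \<theta> = residue_code p m r \<theta> ` {0..m - 1}"

end

theory Submission
  imports Defs
begin

text \<open>A cyclic code whose generator divides \<open>x^n - 1\<close> consists of the polynomials vanishing on a set
  \<open>Z\<close> of \<open>n\<close>-th roots of unity. By Parseval's identity for the discrete Fourier transform its dual
  consists of the polynomials vanishing on the inverses of the roots outside \<open>Z\<close>. Hence the code is
  LCD iff \<open>Z\<close> is closed under inversion, and contains its dual iff \<open>Z\<close> is disjoint from its set of
  inverses. For a residue code the exponents of \<open>Z\<close> form a coset of the subgroup \<open>A\<^sub>0\<close> of the units
  modulo \<open>p\<close>, so the first alternative holds if \<open>-1 \<in> A\<^sub>0\<close>, i.e. if \<open>(p - 1) / m\<close> is even,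
  and the second one otherwise.\<close>

section \<open>Preliminaries on polynomials, finite fields and congruences\<close>

lemma poly_eq_sum_lessThan:
  fixes c :: "'a::comm_semiring_1 poly"
  assumes "degree c < n"
  shows "poly c x = (\<Sum>k<n. Polynomial.coeff c k * x ^ k)"
proof -
  have "poly c x = (\<Sum>k\<le>degree c. Polynomial.coeff c k * x ^ k)"
    by (rule poly_altdef)
  also have "\<dots> = (\<Sum>k<n. Polynomial.coeff c k * x ^ k)"
    by (rule sum.mono_neutral_left) (use assms in \<open>auto simp: coeff_eq_0\<close>)
  finally show ?thesis .
qed

text \<open>Zeros can be split off one at a time: the product over the earlier zeros does not vanish
  at a new zero \<open>a\<close>, so in an integral domain the cofactor must vanish there.\<close>

lemma prod_linear_factors_dvd:
  fixes c :: "'a::idom poly"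
  assumes "finite Z" and "\<And>z. z \<in> Z \<Longrightarrow> poly c z = 0"
  shows "(\<Prod>z\<in>Z. [:- z, 1:]) dvd c"
  using assms
proof (induction Z)
  case empty
  then show ?case by simp
next
  case (insert a Z)
  then obtain d where d: "c = (\<Prod>z\<in>Z. [:- z, 1:]) * d"
    by (auto elim!: dvdE)
  have "poly (\<Prod>z\<in>Z. [:- z, 1:]) a \<noteq> 0"
    using insert.hyps by (auto simp: poly_prod)
  moreover have "poly c a = 0"
    using insert.prems by simp
  ultimately have "poly d a = 0"
    unfolding d by simp
  then obtain e where "d = [:- a, 1:] * e"
    by (auto simp: poly_eq_0_iff_dvd elim!: dvdE)
  then show ?case
    using insert.hyps d by (auto simp: mult_ac simp del: mult_pCons_left mult_pCons_right)
qed

text \<open>Translation by 1 permutes the field, so adding 1 to each element leaves the sum of all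
  elements unchanged.\<close>

lemma of_nat_card_finite_field: "of_nat CARD('a) = (0::'a::{field,finite})"
proof -
  have "(\<Sum>x\<in>UNIV. x) = (\<Sum>x\<in>UNIV. x + (1::'a))"
    by (rule sum.reindex_bij_witness[where i = "\<lambda>x. x + 1" and j = "\<lambda>x. x - 1"]) auto
  then show ?thesis
    by (simp add: sum.distrib)
qed

text \<open>After cancelling 1, both sides and the modulus are multiples of \<open>m\<close>, and
  dividing by it leaves a congruence modulo 2. This lemma and the next will be applied with
  \<open>m * e + 1\<close> equal to the prime \<open>p\<close>.\<close>

lemma cong_add_one_mod_double_iff_odd:
  fixes m e :: nat
  assumes "m > 0"
  shows "[m * e + 1 = m + 1] (mod 2 * m) \<longleftrightarrow> odd e"
proof -
  have "[m * e + 1 = m + 1] (mod 2 * m) \<longleftrightarrow> [m * e = m * 1] (mod m * 2)"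
    by (simp only: cong_add_rcancel_nat mult.commute mult_1_right mult_1_left)
  also have "\<dots> \<longleftrightarrow> [e = 1] (mod 2)"
    using assms unfolding cong_def mod_mult_mult1 by simp
  finally show ?thesis
    by (simp add: cong_def odd_iff_mod_2_eq_one)
qed

lemma cong_one_mod_double_iff_even:
  fixes m e :: nat
  assumes "m > 0"
  shows "[m * e + 1 = 1] (mod 2 * m) \<longleftrightarrow> even e"
proof -
  have "[m * e + 1 = 1] (mod 2 * m) \<longleftrightarrow> m * 2 dvd m * e"
    unfolding cong_add_rcancel_0_nat by (simp only: cong_0_iff mult.commute)
  then show ?thesis
    using assms by simp
qed

section \<open>Codes described by prescribed zeros\<close>

text \<open>If \<open>Z\<close> consists of \<open>n\<close>-th roots of unity, this is the cyclic
  code with defining set \<open>Z\<close>. In this form duality and inclusion of codes become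
  statements about sets of roots.\<close>

definition code_of_zeros :: "nat \<Rightarrow> 'a::field set \<Rightarrow> 'a vec set" where
  "code_of_zeros n Z =
     {vec n (Polynomial.coeff c) | c. degree c < n \<and> (\<forall>z\<in>Z. poly c z = 0)}"

lemma vec_coeff_eq_iff:
  assumes "degree c < n" and "degree d < n"
  shows "vec n (Polynomial.coeff c) = vec n (Polynomial.coeff d) \<longleftrightarrow> c = d"
proof
  assume *: "vec n (Polynomial.coeff c) = vec n (Polynomial.coeff d)"
  have "Polynomial.coeff c k = Polynomial.coeff d k" for k
  proof (cases "k < n")
    case True
    then show ?thesis using * by (metis index_vec)
  next
    case False
    then show ?thesis using assms by (simp add: coeff_eq_0)
  qed
  then show "c = d" by (simp add: poly_eq_iff)
qed simp

lemma vec_coeff_in_code_of_zeros_iff: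
  assumes "degree c < n"
  shows "vec n (Polynomial.coeff c) \<in> code_of_zeros n Z \<longleftrightarrow> (\<forall>z\<in>Z. poly c z = 0)"
  using assms by (auto simp: code_of_zeros_def vec_coeff_eq_iff)

lemma carrier_vec_eq_vec_coeff:
  fixes v :: "'a::comm_monoid_add vec"
  assumes "n > 0" and "v \<in> carrier_vec n"
  obtains c where "degree c < n" and "v = vec n (Polynomial.coeff c)"
proof
  let ?c = "\<Sum>k<n. Polynomial.monom (v $ k) k"
  have coeff: "Polynomial.coeff ?c k = (if k < n then v $ k else 0)" for k
    by (simp add: coeff_sum sum.delta)
  show "degree ?c < n"
    by (rule degree_lessI) (use assms coeff in auto)
  show "v = vec n (Polynomial.coeff ?c)"
    using assms coeff by auto
qed

section \<open>Fourier analysis on the \<open>n\<close>-th roots of unity, and duality of cyclic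
  codes\<close>

locale root_of_unity_field =
  fixes n :: nat and \<theta> :: "'a::field"
  assumes primitive: "primitive_root_of_unity n \<theta>"
    and of_nat_neq_0: "of_nat n \<noteq> (0::'a)"
begin

definition unity_roots :: "'a set" where
  "unity_roots = (\<lambda>i. \<theta> ^ i) ` {..<n}"

lemma n_pos: "n > 0" and root_power_n: "\<theta> ^ n = 1"
  and root_power_neq_1: "0 < k \<Longrightarrow> k < n \<Longrightarrow> \<theta> ^ k \<noteq> 1"
  using primitive by (auto simp: primitive_root_of_unity_def)

lemma root_neq_0: "\<theta> \<noteq> 0"
  using root_power_n n_pos by (auto simp: power_0_left)

lemma inj_on_root_power: "inj_on (\<lambda>i. \<theta> ^ i) {..<n}"
proof (rule linorder_inj_onI)
  fix i j assume "i < j" and "i \<in> {..<n}" and "j \<in> {..<n}"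
  then have "\<theta> ^ (j - i) \<noteq> 1"
    by (intro root_power_neq_1) auto
  then show "\<theta> ^ i \<noteq> \<theta> ^ j"
    using \<open>i < j\<close> root_neq_0 by (simp add: power_diff)
qed auto

lemma card_unity_roots: "card unity_roots = n"
  unfolding unity_roots_def using inj_on_root_power by (simp add: card_image)

lemma finite_unity_roots: "finite unity_roots"
  by (simp add: unity_roots_def)

lemma unity_rootD: "z \<in> unity_roots \<Longrightarrow> z ^ n = 1"
  unfolding unity_roots_def by (metis image_iff mult.commute power_mult power_one root_power_n)

lemma inverse_root_power:
  assumes "i \<le> n"
  shows "inverse (\<theta> ^ i) = \<theta> ^ (n - i)"
  using assms root_neq_0 root_power_n by (simp add: power_diff field_simps)

lemma inverse_unity_root: "z \<in> unity_roots \<Longrightarrow> inverse z \<in> unity_roots"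
proof -
  assume "z \<in> unity_roots"
  then obtain i where i: "i < n" "z = \<theta> ^ i"
    by (auto simp: unity_roots_def)
  show ?thesis
  proof (cases "i = 0")
    case True
    then show ?thesis using i n_pos by (auto simp: unity_roots_def intro: image_eqI[of _ _ 0])
  next
    case False
    then show ?thesis
      using i inverse_root_power[of i] by (auto simp: unity_roots_def)
  qed
qed

text \<open>Orthogonality of characters: the sum is a geometric series whose ratio is an
  \<open>n\<close>-th root of unity, equal to 1 only if \<open>k = l\<close>.\<close>

lemma sum_unity_roots_power:
  assumes "k < n" and "l < n"
  shows "(\<Sum>z\<in>unity_roots. inverse z ^ k * z ^ l) = (if k = l then of_nat n else 0)"
proof -
  \<comment> \<open>The ratio of the geometric series; it stands for theta to the power l - k, which
    may be a negative exponent.\<close>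
  define w where "w = inverse (\<theta> ^ k) * \<theta> ^ l"
  have "(\<Sum>z\<in>unity_roots. inverse z ^ k * z ^ l)
      = (\<Sum>i<n. inverse (\<theta> ^ i) ^ k * (\<theta> ^ i) ^ l)"
    unfolding unity_roots_def by (simp add: sum.reindex[OF inj_on_root_power])
  also have "\<dots> = (\<Sum>i<n. w ^ i)"
    by (simp add: w_def power_mult_distrib power_inverse mult.commute flip: power_mult)
  also have "\<dots> = (if k = l then of_nat n else 0)"
  proof (cases "k = l")
    case True
    then have "w = 1" using root_neq_0 by (simp add: w_def)
    then show ?thesis using True by simp
  next
    case False
    then have "\<theta> ^ k \<noteq> \<theta> ^ l"
      using assms inj_on_root_power by (auto dest: inj_onD)
    then have "w \<noteq> 1"
      using root_neq_0 by (simp add: w_def field_simps)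
    moreover have "w ^ n = 1"
      using root_power_n
      by (simp add: w_def power_mult_distrib power_inverse flip: power_mult)
        (metis inverse_1 mult.commute mult_1_left power_mult power_one)
    ultimately show ?thesis
      using False by (simp add: sum_gp_strict)
  qed
  finally show ?thesis .
qed

text \<open>Expanding both evaluations into coefficients and summing over the roots first,
  orthogonality kills every term off the diagonal. Evaluation at \<open>inverse z\<close> plays the
  part of complex conjugation.\<close>

lemma parseval:
  assumes "degree v < n" and "degree c < n"
  shows "of_nat n * (vec n (Polynomial.coeff v) \<bullet> vec n (Polynomial.coeff c))
    = (\<Sum>z\<in>unity_roots. poly v (inverse z) * poly c z)"
proof -
  let ?v = "Polynomial.coeff v" and ?c = "Polynomial.coeff c"
  have "(\<Sum>z\<in>unity_roots. poly v (inverse z) * poly c z)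
      = (\<Sum>z\<in>unity_roots. \<Sum>k<n. \<Sum>l<n. ?v k * ?c l * (inverse z ^ k * z ^ l))"
    unfolding poly_eq_sum_lessThan[OF assms(1)] poly_eq_sum_lessThan[OF assms(2)] sum_product
    by (simp add: mult_ac)
  also have "\<dots> = (\<Sum>k<n. \<Sum>l<n. \<Sum>z\<in>unity_roots. ?v k * ?c l * (inverse z ^ k * z ^ l))"
    by (subst sum.swap, rule sum.cong[OF refl], rule sum.swap)
  also have "\<dots> = (\<Sum>k<n. \<Sum>l<n. ?v k * ?c l * (if k = l then of_nat n else 0))"
    by (intro sum.cong refl) (simp only: sum_unity_roots_power lessThan_iff flip: sum_distrib_left)
  also have "\<dots> = (\<Sum>k<n. ?v k * ?c k * of_nat n)"
    by (intro sum.cong refl) (simp add: if_distrib sum.delta cong: if_cong)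
  also have "\<dots> = of_nat n * (vec n ?v \<bullet> vec n ?c)"
    by (simp add: scalar_prod_def sum_distrib_left mult_ac lessThan_atLeast0)
  finally show ?thesis by simp
qed

text \<open>Each element of \<open>Z\<close> is a root of x^n - 1, so reduction modulo x^n - 1 does
  not change values on \<open>Z\<close>. Conversely, a polynomial vanishing on \<open>Z\<close> is a
  multiple of the generator.\<close>

lemma cyclic_code_eq_code_of_zeros:
  assumes "Z \<subseteq> unity_roots"
  shows "cyclic_code n (\<Prod>z\<in>Z. [:- z, 1:]) = code_of_zeros n Z"
proof -
  let ?M = "Polynomial.monom 1 n - 1 :: 'a poly" and ?g = "\<Prod>z\<in>Z. [:- z, 1:]"
  have finite: "finite Z"
    using assms finite_unity_roots finite_subset by blast
  have M_root: "poly ?M z = 0" if "z \<in> Z" for z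
    using that assms unity_rootD by (auto simp: poly_monom)
  have deg_M: "degree ?M = n"
    using n_pos degree_add_eq_left[of "- 1" "Polynomial.monom 1 n :: 'a poly"]
    by (simp add: degree_monom_eq)
  have "(PIdl\<^bsub>cyclic_ring n\<^esub> (?g mod ?M)) = {c. degree c < n \<and> (\<forall>z\<in>Z. poly c z = 0)}"
  proof (intro equalityI subsetI)
    fix c assume "c \<in> (PIdl\<^bsub>cyclic_ring n\<^esub> (?g mod ?M))"
    then obtain x where c: "c = (x * (?g mod ?M)) mod ?M"
      by (auto simp: cgenideal_def cyclic_ring_def)
    have "degree c < n"
      using degree_mod_less[of ?M "x * (?g mod ?M)"] deg_M n_pos unfolding c by fastforce
    moreover have "poly c z = 0" if "z \<in> Z" for z
      using that finite M_root[OF that] unfolding c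
      by (auto simp: poly_mod poly_prod)
    ultimately show "c \<in> {c. degree c < n \<and> (\<forall>z\<in>Z. poly c z = 0)}"
      by simp
  next
    fix c assume "c \<in> {c. degree c < n \<and> (\<forall>z\<in>Z. poly c z = 0)}"
    then have deg_c: "degree c < n" and "?g dvd c"
      using prod_linear_factors_dvd[OF finite] by auto
    then obtain d where d: "c = ?g * d" by (elim dvdE)
    \<comment> \<open>The cofactor \<open>d\<close> has to lie in the carrier of the ring, so its
      degree must be below \<open>n\<close> as well.\<close>
    have "?g \<noteq> 0" using finite by simp
    then have "degree d < n"
      using deg_c d by (cases "d = 0") (auto simp: degree_mult_eq)
    moreover have "c = (d * (?g mod ?M)) mod ?M"
      using deg_c deg_M d by (simp add: mod_mult_right_eq mult.commute mod_poly_less)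
    ultimately show "c \<in> (PIdl\<^bsub>cyclic_ring n\<^esub> (?g mod ?M))"
      by (auto simp: cgenideal_def cyclic_ring_def)
  qed
  then show ?thesis
    by (auto simp: cyclic_code_def code_of_zeros_def)
qed

text \<open>An unnormalised Lagrange basis polynomial: it has one linear factor for each of the
  other n - 1 roots. It serves below as the test word concentrated at a single root.\<close>

lemma separating_poly:
  assumes "z0 \<in> unity_roots"
  obtains c where "degree c < n" and "poly c z0 \<noteq> 0"
    and "\<And>z. z \<in> unity_roots \<Longrightarrow> z \<noteq> z0 \<Longrightarrow> poly c z = 0"
proof
  let ?c = "\<Prod>z\<in>unity_roots - {z0}. [:- z, 1:]"
  show "degree ?c < n"
    using assms finite_unity_roots card_unity_roots n_pos
    by (subst degree_prod_sum_eq) (auto simp: card_Diff_singleton)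
  show "poly ?c z0 \<noteq> 0"
    using finite_unity_roots by (auto simp: poly_prod)
  show "poly ?c z = 0" if "z \<in> unity_roots" "z \<noteq> z0" for z
    using that finite_unity_roots by (auto simp: poly_prod)
qed

lemma poly_eq_0_if_unity_roots:
  assumes "degree c < n" and "\<And>z. z \<in> unity_roots \<Longrightarrow> poly c z = 0"
  shows "c = 0"
proof (rule ccontr)
  assume "c \<noteq> 0"
  have "card unity_roots \<le> card {z. poly c z = 0}"
    by (rule card_mono) (use assms \<open>c \<noteq> 0\<close> poly_roots_finite in auto)
  also have "\<dots> \<le> degree c"
    using \<open>c \<noteq> 0\<close> by (rule card_poly_roots_bound)
  finally show False using assms(1) card_unity_roots by simp
qed

text \<open>By Parseval, testing \<open>v\<close> against a codeword concentrated at a root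
  \<open>z0\<close> outside \<open>Z\<close> isolates the value of \<open>v\<close> at
  \<open>inverse z0\<close>. Conversely, each summand has a vanishing factor: that of
  \<open>c\<close> on \<open>Z\<close>, that of \<open>v\<close> off \<open>Z\<close>.\<close>

lemma vec_coeff_in_dual_iff:
  assumes "Z \<subseteq> unity_roots" and "degree v < n"
  shows "vec n (Polynomial.coeff v) \<in> dual_code n (code_of_zeros n Z) \<longleftrightarrow>
    (\<forall>z\<in>unity_roots - Z. poly v (inverse z) = 0)"
proof
  assume v: "vec n (Polynomial.coeff v) \<in> dual_code n (code_of_zeros n Z)"
  show "\<forall>z\<in>unity_roots - Z. poly v (inverse z) = 0"
  proof
    fix z0 assume z0: "z0 \<in> unity_roots - Z"
    then obtain c where c: "degree c < n" "poly c z0 \<noteq> 0"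
      "\<And>z. z \<in> unity_roots \<Longrightarrow> z \<noteq> z0 \<Longrightarrow> poly c z = 0"
      using separating_poly by blast
    have "vec n (Polynomial.coeff c) \<in> code_of_zeros n Z"
      using assms z0 c by (auto simp: vec_coeff_in_code_of_zeros_iff)
    then have "0 = (\<Sum>z\<in>unity_roots. poly v (inverse z) * poly c z)"
      using v parseval[OF assms(2) c(1)] by (simp add: dual_code_def)
    also have "\<dots> = (\<Sum>z\<in>{z0}. poly v (inverse z) * poly c z)"
      by (rule sum.mono_neutral_right) (use z0 c(3) finite_unity_roots in auto)
    finally show "poly v (inverse z0) = 0"
      using c(2) by simp
  qed
next
  assume v: "\<forall>z\<in>unity_roots - Z. poly v (inverse z) = 0"
  have "vec n (Polynomial.coeff v) \<bullet> vec n (Polynomial.coeff c) = 0"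
    if c: "degree c < n" "\<forall>z\<in>Z. poly c z = 0" for c
  proof -
    have "(\<Sum>z\<in>unity_roots. poly v (inverse z) * poly c z) = 0"
      using v c(2) by (intro sum.neutral) auto
    \<comment> \<open>Parseval gives only \<open>n\<close> times the inner product; \<open>n\<close>
      is cancelled because it is nonzero in the field.\<close>
    then show ?thesis
      using parseval[OF assms(2) c(1)] of_nat_neq_0 by simp
  qed
  then show "vec n (Polynomial.coeff v) \<in> dual_code n (code_of_zeros n Z)"
    by (auto simp: dual_code_def code_of_zeros_def)
qed

text \<open>A word in the code and its dual vanishes on \<open>Z\<close> and on the inverses of the
  roots outside \<open>Z\<close>. These are all the roots of unity exactly when no element of
  \<open>Z\<close> has its inverse outside \<open>Z\<close>; a root left over carries a nonzero
  common word.\<close>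

lemma LCD_code_of_zeros_iff:
  assumes "Z \<subseteq> unity_roots"
  shows "LCD_code n (code_of_zeros n Z) \<longleftrightarrow> inverse ` Z \<subseteq> Z"
proof
  assume LCD: "LCD_code n (code_of_zeros n Z)"
  show "inverse ` Z \<subseteq> Z"
  proof (rule ccontr)
    assume "\<not> inverse ` Z \<subseteq> Z"
    then obtain z0 where z0: "z0 \<in> Z" "inverse z0 \<notin> Z" by auto
    then have "inverse z0 \<in> unity_roots"
      using assms inverse_unity_root by auto
    then obtain c where c: "degree c < n" "poly c (inverse z0) \<noteq> 0"
      "\<And>z. z \<in> unity_roots \<Longrightarrow> z \<noteq> inverse z0 \<Longrightarrow> poly c z = 0"
      using separating_poly by blast
    \<comment> \<open>The root \<open>inverse z0\<close> is neither in \<open>Z\<close> nor the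
      inverse of a root outside \<open>Z\<close>, so both vanishing conditions avoid the only root
      where \<open>c\<close> is nonzero.\<close>
    have "\<forall>z\<in>Z. poly c z = 0"
      using c(3) z0(2) assms by auto
    moreover have "\<forall>z\<in>unity_roots - Z. poly c (inverse z) = 0"
      using c(3) z0(1) inverse_unity_root by (metis DiffD1 DiffD2 inverse_inverse_eq)
    ultimately have "vec n (Polynomial.coeff c) \<in> {0\<^sub>v n}"
      using LCD c(1) assms
      by (auto simp: LCD_code_def vec_coeff_in_dual_iff vec_coeff_in_code_of_zeros_iff)
    then have "vec n (Polynomial.coeff c) = vec n (Polynomial.coeff 0)"
      by auto
    then have "c = 0"
      using c(1) n_pos vec_coeff_eq_iff[of c n 0] by simp
    then show False using c(2) by simp
  qed
next
  assume Z: "inverse ` Z \<subseteq> Z"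
  show "LCD_code n (code_of_zeros n Z)"
    unfolding LCD_code_def
  proof (intro equalityI subsetI)
    fix w assume w: "w \<in> code_of_zeros n Z \<inter> dual_code n (code_of_zeros n Z)"
    then obtain c where c: "degree c < n" "w = vec n (Polynomial.coeff c)" "\<forall>z\<in>Z. poly c z = 0"
      by (auto simp: code_of_zeros_def)
    have "\<forall>z\<in>unity_roots - Z. poly c (inverse z) = 0"
      using w c vec_coeff_in_dual_iff[OF assms c(1)] by simp
    then have "poly c z = 0" if "z \<in> unity_roots" for z
      using that c(3) Z inverse_unity_root[OF that]
      by (metis Diff_iff image_subset_iff inverse_inverse_eq)
    then have "c = 0"
      using c(1) poly_eq_0_if_unity_roots by blast
    then show "w \<in> {0\<^sub>v n}"
      using c(2) by auto
  next
    fix w assume "w \<in> {0\<^sub>v n :: 'a vec}"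
    then have w: "w = vec n (Polynomial.coeff 0)" by auto
    show "w \<in> code_of_zeros n Z \<inter> dual_code n (code_of_zeros n Z)"
      unfolding w using n_pos assms
      by (simp add: vec_coeff_in_dual_iff vec_coeff_in_code_of_zeros_iff del: coeff_0)
  qed
qed

text \<open>The zeros of the dual are the inverses of the roots outside \<open>Z\<close>. The dual
  lies in the code when these include all of \<open>Z\<close>, that is, when no element of
  \<open>Z\<close> is the inverse of an element of \<open>Z\<close>.\<close>

lemma self_orthogonal_code_of_zeros_iff:
  assumes "Z \<subseteq> unity_roots"
  shows "self_orthogonal_code n (code_of_zeros n Z) \<longleftrightarrow> inverse ` Z \<inter> Z = {}"
proof
  assume so: "self_orthogonal_code n (code_of_zeros n Z)"
  show "inverse ` Z \<inter> Z = {}"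
  proof (rule ccontr)
    assume "inverse ` Z \<inter> Z \<noteq> {}"
    then obtain z0 where z0: "z0 \<in> Z" "inverse z0 \<in> Z" by auto
    then obtain c where c: "degree c < n" "poly c z0 \<noteq> 0"
      "\<And>z. z \<in> unity_roots \<Longrightarrow> z \<noteq> z0 \<Longrightarrow> poly c z = 0"
      using separating_poly assms by blast
    \<comment> \<open>Since \<open>inverse z0\<close> lies in \<open>Z\<close>, the root
      \<open>z0\<close> is not among the zeros required by the dual: \<open>c\<close> is in the dual
      but does not vanish at \<open>z0\<close>.\<close>
    have "\<forall>z\<in>unity_roots - Z. poly c (inverse z) = 0"
      using c(3) z0(2) inverse_unity_root by (metis DiffD1 DiffD2 inverse_inverse_eq)
    then have "vec n (Polynomial.coeff c) \<in> code_of_zeros n Z"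
      using so c(1) assms vec_coeff_in_dual_iff by (auto simp: self_orthogonal_code_def)
    then show False
      using c z0(1) by (simp add: vec_coeff_in_code_of_zeros_iff)
  qed
next
  assume Z: "inverse ` Z \<inter> Z = {}"
  have "dual_code n (code_of_zeros n Z) \<subseteq> code_of_zeros n Z"
  proof
    fix w assume w: "w \<in> dual_code n (code_of_zeros n Z)"
    then obtain c where c: "degree c < n" "w = vec n (Polynomial.coeff c)"
      using carrier_vec_eq_vec_coeff[OF n_pos] by (auto simp: dual_code_def)
    have "\<forall>z\<in>unity_roots - Z. poly c (inverse z) = 0"
      using w c vec_coeff_in_dual_iff[OF assms c(1)] by simp
    then have "poly c z = 0" if "z \<in> Z" for z
      using that assms Z inverse_unity_root
      by (metis DiffI disjoint_iff image_eqI inverse_inverse_eq subsetD)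
    then show "w \<in> code_of_zeros n Z"
      using c by (simp add: vec_coeff_in_code_of_zeros_iff)
  qed
  then show "self_orthogonal_code n (code_of_zeros n Z)"
    by (auto simp: self_orthogonal_code_def)
qed

text \<open>A root in \<open>Z'\<close> but not in \<open>Z\<close> would carry a test word
  belonging to the first code only. The resulting injectivity is what allows codes to be counted by
  their zero sets.\<close>

lemma code_of_zeros_subset_imp:
  assumes "Z' \<subseteq> unity_roots" "Z \<subseteq> unity_roots"
    and "code_of_zeros n Z \<subseteq> code_of_zeros n Z'"
  shows "Z' \<subseteq> Z"
proof
  fix z0 assume z0: "z0 \<in> Z'"
  then obtain c where c: "degree c < n" "poly c z0 \<noteq> 0"
    "\<And>z. z \<in> unity_roots \<Longrightarrow> z \<noteq> z0 \<Longrightarrow> poly c z = 0"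
    using separating_poly assms by blast
  show "z0 \<in> Z"
  proof (rule ccontr)
    assume "z0 \<notin> Z"
    then have "vec n (Polynomial.coeff c) \<in> code_of_zeros n Z"
      using c assms(2) by (auto simp: vec_coeff_in_code_of_zeros_iff)
    then have "vec n (Polynomial.coeff c) \<in> code_of_zeros n Z'"
      using assms(3) by blast
    then show False
      using z0 c by (simp add: vec_coeff_in_code_of_zeros_iff)
  qed
qed

lemma inj_on_code_of_zeros: "inj_on (code_of_zeros n) (Pow unity_roots)"
  using code_of_zeros_subset_imp by (intro inj_onI) (metis PowD order_antisym subset_refl)

end

section \<open>Residue classes modulo \<open>p\<close>\<close>

text \<open>Raising to the power (p - 1) / m is a homomorphism on the units modulo \<open>p\<close>
  with kernel \<open>residue_class0 p m\<close>, so the coset of r^j is the fibre over the image of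
  r^j.\<close>

lemma residue_class_iff:
  assumes "prime p" and "m dvd p - 1" and "coprime p r"
  shows "i \<in> residue_class p m r j \<longleftrightarrow>
    0 < i \<and> i < p \<and> [i ^ ((p - 1) div m) = r ^ (j * ((p - 1) div m))] (mod p)"
proof -
  define e where "e = (p - 1) div m"
  have p: "p > 1" using assms(1) by (rule prime_gt_1_nat)
  have fermat: "[r ^ (p - 1) = 1] (mod p)"
    using assms by (metis fermat_theorem coprime_absorb_left not_prime_unit)
  show ?thesis
    unfolding e_def[symmetric]
  proof
    assume "i \<in> residue_class p m r j"
    then obtain k where i: "i = (r ^ j * k) mod p" and k: "1 \<le> k" "k \<le> p - 1" "[k ^ e = 1] (mod p)"
      by (auto simp: residue_class_def residue_class0_def e_def)
    have "\<not> p dvd k"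
      using k p by (auto dest: dvd_imp_le)
    moreover have "\<not> p dvd r ^ j"
      using assms p by (metis coprime_absorb_left coprime_power_right_iff not_prime_unit)
    ultimately have "i \<noteq> 0"
      using assms(1) i by (auto simp: prime_dvd_mult_iff mod_eq_0_iff_dvd)
    moreover have "[i ^ e = (r ^ j * k) ^ e] (mod p)"
      unfolding i by (simp add: cong_def power_mod)
    moreover have "[(r ^ j * k) ^ e = r ^ (j * e) * 1] (mod p)"
      unfolding power_mult_distrib power_mult using k(3) by (intro cong_mult cong_refl)
    ultimately show "0 < i \<and> i < p \<and> [i ^ e = r ^ (j * e)] (mod p)"
      using p by (auto simp: i intro: cong_trans)
  next
    assume i: "0 < i \<and> i < p \<and> [i ^ e = r ^ (j * e)] (mod p)"
    \<comment> \<open>An inverse of r^j modulo \<open>p\<close>, by Fermat's theorem; it recovers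
      \<open>k\<close> from \<open>i\<close>.\<close>
    define s where "s = r ^ (j * (p - 2))"
    have rs: "[r ^ j * s = 1] (mod p)"
    proof -
      have "p - 1 = Suc (p - 2)" using p by simp
      then have "r ^ j * s = (r ^ (p - 1)) ^ j"
        by (simp add: s_def power_add algebra_simps flip: power_mult)
      also have "[\<dots> = 1 ^ j] (mod p)"
        using fermat by (rule cong_pow)
      finally show ?thesis by simp
    qed
    define k where "k = (s * i) mod p"
    have "[r ^ j * k = r ^ j * (s * i)] (mod p)"
      by (simp add: k_def cong_def mod_mult_right_eq)
    also have "r ^ j * (s * i) = r ^ j * s * i"
      by (simp add: mult.assoc)
    also have "[\<dots> = 1 * i] (mod p)"
      using rs by (intro cong_mult cong_refl)
    finally have rk: "i = (r ^ j * k) mod p"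
      using i by (simp add: cong_def)
    then have "k \<noteq> 0" using i by (intro notI) simp
    moreover have "k < p" using p by (simp add: k_def)
    moreover have "[k ^ e = 1] (mod p)"
    proof -
      have "[k ^ e = (s * i) ^ e] (mod p)"
        unfolding k_def by (simp add: cong_def power_mod)
      also have "(s * i) ^ e = s ^ e * i ^ e"
        by (rule power_mult_distrib)
      also have "[\<dots> = s ^ e * r ^ (j * e)] (mod p)"
        using i by (intro cong_mult cong_refl) auto
      also have "s ^ e * r ^ (j * e) = (r ^ j * s) ^ e"
        unfolding power_mult_distrib power_mult by (rule mult.commute)
      also have "[\<dots> = 1 ^ e] (mod p)"
        using rs by (rule cong_pow)
      finally show ?thesis by simp
    qed
    ultimately have "k \<in> residue_class0 p m"
      using p by (auto simp: residue_class0_def e_def)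
    then show "i \<in> residue_class p m r j"
      using rk by (auto simp: residue_class_def)
  qed
qed

text \<open>The number \<open>p - i\<close> represents the negative of \<open>i\<close>; the
  integers are used so that the sign can be written.\<close>

lemma cong_diff_power:
  fixes p i e :: nat
  assumes "i \<le> p"
  shows "[int ((p - i) ^ e) = (- 1) ^ e * int (i ^ e)] (mod int p)"
proof -
  have "[int (p - i) = - int i] (mod int p)"
    using assms by (simp add: cong_iff_dvd_diff)
  then have "[int (p - i) ^ e = (- int i) ^ e] (mod int p)"
    by (rule cong_pow)
  then show ?thesis by (simp add: power_minus[of "int i"])
qed

text \<open>Negating \<open>i\<close> multiplies its \<open>e\<close>-th power by (-1)^e, so it
  stays in the same fibre if \<open>e\<close> is even. For odd \<open>e\<close> this would force
  \<open>p\<close> to divide 2 i^e, impossible for an odd prime and 0 < i < p.\<close>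

lemma residue_class_diff:
  assumes "prime p" and "odd p" and "m dvd p - 1" and "coprime p r"
    and "i \<in> residue_class p m r j"
  shows "p - i \<in> residue_class p m r j \<longleftrightarrow> even ((p - 1) div m)"
proof -
  define e where "e = (p - 1) div m"
  have i: "0 < i" "i < p" "[i ^ e = r ^ (j * e)] (mod p)"
    using assms by (auto simp: residue_class_iff e_def)
  have "p - i \<in> residue_class p m r j \<longleftrightarrow> [(p - i) ^ e = r ^ (j * e)] (mod p)"
    using assms i by (simp add: residue_class_iff e_def)
  also have "\<dots> \<longleftrightarrow> [(p - i) ^ e = i ^ e] (mod p)"
    using i(3) by (meson cong_sym cong_trans)
  also have "\<dots> \<longleftrightarrow> [int ((p - i) ^ e) = int (i ^ e)] (mod int p)"
    by (simp only: cong_int_iff)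
  also have "\<dots> \<longleftrightarrow> [(- 1) ^ e * int (i ^ e) = int (i ^ e)] (mod int p)"
    using cong_diff_power[of i p e] i by (meson cong_sym cong_trans less_imp_le)
  also have "\<dots> \<longleftrightarrow> even e"
  proof (cases "even e")
    case False
    have "\<not> p dvd 2 * i ^ e"
    proof
      assume "p dvd 2 * i ^ e"
      then have "p dvd 2 \<or> p dvd i"
        using assms(1) by (auto simp: prime_dvd_mult_iff dest: prime_dvd_power)
      then show False
      proof
        assume "p dvd 2"
        then have "p = 2"
          using assms(1) by (simp add: primes_dvd_imp_eq)
        then show False using assms(2) by simp
      next
        assume "p dvd i"
        then show False using i(1,2) by (simp add: nat_dvd_not_less)
      qed
    qed
    moreover have "int p dvd - int (i ^ e) - int (i ^ e) \<longleftrightarrow> p dvd 2 * i ^ e"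
    proof -
      have "- int (i ^ e) - int (i ^ e) = - int (2 * i ^ e)" by simp
      then show ?thesis by (simp only: dvd_minus_iff int_dvd_int_iff)
    qed
    ultimately show ?thesis
      using False by (simp add: cong_iff_dvd_diff)
  qed simp
  finally show ?thesis by (simp only: e_def)
qed

text \<open>This representative shows that a class is nonempty, and it serves to tell different
  classes apart.\<close>

lemma power_mod_in_residue_class:
  assumes "prime p" and "m dvd p - 1" and "coprime p r"
  shows "r ^ j mod p \<in> residue_class p m r j"
proof -
  have "\<not> p dvd r ^ j"
    using assms by (metis coprime_absorb_left coprime_power_right_iff not_prime_unit)
  then show ?thesis
    using assms prime_gt_0_nat[OF assms(1)]
    by (simp add: residue_class_iff cong_def power_mod mod_greater_zero_iff_not_dvd flip: power_mult)
qed

text \<open>As \<open>r\<close> has order p - 1 = m e, equal powers r^(j e) and r^(k e) force j and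
  k to agree modulo \<open>m\<close>.\<close>

lemma inj_on_residue_class:
  assumes "prime p" and "m dvd p - 1" and "residue_primroot p r"
  shows "inj_on (residue_class p m r) {..<m}"
proof (rule inj_onI)
  fix j k assume jk: "j \<in> {..<m}" "k \<in> {..<m}" "residue_class p m r j = residue_class p m r k"
  define e where "e = (p - 1) div m"
  have pm: "p - 1 = m * e" using assms(2) by (simp add: e_def)
  have "p - 1 > 0" using prime_gt_1_nat[OF assms(1)] by simp
  then have "e > 0" using pm by (intro gr0I) simp
  have r: "coprime p r" "ord p r = m * e"
    using assms(1,3) pm by (auto simp: residue_primroot_def totient_prime)
  have "r ^ j mod p \<in> residue_class p m r k"
    using power_mod_in_residue_class[OF assms(1,2) r(1), of j] jk(3) by simp
  then have "[(r ^ j mod p) ^ e = r ^ (k * e)] (mod p)"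
    using assms r(1) by (simp add: residue_class_iff e_def)
  then have "[r ^ (j * e) = r ^ (k * e)] (mod p)"
    by (simp add: cong_def power_mod power_mult)
  then have "[j * e = k * e] (mod m * e)"
    using order_divides_expdiff[OF r(1)] r(2) by simp
  then show "j = k"
    using jk(1,2) \<open>e > 0\<close> by (simp add: cong_def)
qed

section \<open>LCD and self-orthogonal residue codes\<close>

theorem theorem3p3:
  fixes p m q r :: nat and \<theta> :: "'a::{field,finite}"
  assumes "prime p" and "odd p"
    and "m \<ge> 2" and "m dvd p - 1"
    and "primepow q" and "CARD('a) = q" and "p dvd q - 1"
    and "primitive_root_of_unity p \<theta>"
    and "residue_primroot p r"
  shows "((\<exists>C\<in>residue_codes p m r \<theta>. LCD_code p C) \<longleftrightarrow> [p = 1] (mod 2 * m))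
    \<and> card {C \<in> residue_codes p m r \<theta>. LCD_code p C} \<in> {0, m}
    \<and> ((\<exists>C\<in>residue_codes p m r \<theta>. self_orthogonal_code p C) \<longleftrightarrow> [p = m + 1] (mod 2 * m))
    \<and> card {C \<in> residue_codes p m r \<theta>. self_orthogonal_code p C} \<in> {0, m}"
proof -
  \<comment> \<open>If \<open>p\<close> vanished in the field, so would its multiple
    \<open>q - 1\<close>; but \<open>q\<close>, the size of the field, is itself 0 there, and 0 = 1
    would follow.\<close>
  have "of_nat p \<noteq> (0::'a)"
  proof
    assume "of_nat p = (0::'a)"
    moreover obtain k where "q - 1 = p * k" using assms(7) by (elim dvdE)
    ultimately have "of_nat (q - 1) = (0::'a)" by simp
    moreover have "q = Suc (q - 1)" using assms(5) primepow_gt_0_nat by fastforce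
    ultimately have "of_nat q = (1::'a)" by (metis of_nat_Suc add_0_right)
    then show False using of_nat_card_finite_field[where 'a = 'a] assms(6) by simp
  qed
  then interpret root_of_unity_field p \<theta>
    using assms(8) by unfold_locales
  define e where "e = (p - 1) div m"
  have pe: "p = m * e + 1"
    using assms(4) prime_gt_1_nat[OF assms(1)] by (simp add: e_def)
  have r: "coprime p r"
    using assms(9) by (simp add: residue_primroot_def)
  define A where "A = residue_class p m r"
  define Z where "Z j = (\<lambda>i. \<theta> ^ i) ` A j" for j
  have A: "A j \<subseteq> {..<p}" for j
    using assms(1,4) r by (auto simp: A_def residue_class_iff)
  have Z: "Z j \<subseteq> unity_roots" for j
    using A by (auto simp: Z_def unity_roots_def)
  have code: "residue_code p m r \<theta> j = code_of_zeros p (Z j)" for j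
  proof -
    have "residue_poly p m r \<theta> j = (\<Prod>z\<in>Z j. [:- z, 1:])"
      unfolding residue_poly_def Z_def A_def[symmetric]
      using inj_on_subset[OF inj_on_root_power A] by (simp add: prod.reindex)
    then show ?thesis
      using cyclic_code_eq_code_of_zeros[OF Z] by (simp add: residue_code_def)
  qed
  \<comment> \<open>Inversion of roots is negation of exponents. As 0 < i, the exponent
    \<open>p - i\<close> is again below \<open>p\<close>, where powers of theta are distinct. The
    answer depends neither on \<open>z\<close> nor on \<open>j\<close>.\<close>
  have inverse_in: "inverse z \<in> Z j \<longleftrightarrow> even e" if z: "z \<in> Z j" for z j
  proof -
    obtain i where i: "i \<in> A j" "z = \<theta> ^ i" using z by (auto simp: Z_def)
    have "0 < i" "i < p"
      using i(1) assms(1,4) r by (auto simp: A_def residue_class_iff)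
    then have "inverse z \<in> Z j \<longleftrightarrow> p - i \<in> A j"
      using i(2) inverse_root_power[of i] inj_on_image_mem_iff[OF inj_on_root_power _ A]
      by (simp add: Z_def)
    then show ?thesis
      using residue_class_diff[OF assms(1,2,4) r] i(1) by (simp add: A_def e_def)
  qed
  \<comment> \<open>On an empty zero set both criteria would hold vacuously; nonemptiness makes them
    mutually exclusive.\<close>
  have Z_nonempty: "Z j \<noteq> {}" for j
    using power_mod_in_residue_class[OF assms(1,4) r] by (auto simp: Z_def A_def)
  have LCD: "LCD_code p (residue_code p m r \<theta> j) \<longleftrightarrow> even e" for j
    using LCD_code_of_zeros_iff[OF Z] inverse_in Z_nonempty[of j] by (auto simp: code)
  have so: "self_orthogonal_code p (residue_code p m r \<theta> j) \<longleftrightarrow> odd e" for j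
    using self_orthogonal_code_of_zeros_iff[OF Z] inverse_in Z_nonempty[of j]
    by (fastforce simp: code)
  have codes: "residue_codes p m r \<theta> = residue_code p m r \<theta> ` {..<m}"
    using assms(3) by (auto simp: residue_codes_def intro!: image_eqI)
  \<comment> \<open>The codes form a set, so the count \<open>m\<close> requires that different
    indices give different codes.\<close>
  have inj: "inj_on (residue_code p m r \<theta>) {..<m}"
  proof (rule inj_onI)
    fix j k assume jk: "j \<in> {..<m}" "k \<in> {..<m}"
      "residue_code p m r \<theta> j = residue_code p m r \<theta> k"
    then have "Z j = Z k"
      using inj_onD[OF inj_on_code_of_zeros] Z by (simp add: code)
    then have "A j = A k"
      using inj_on_image_eq_iff[OF inj_on_root_power A A] by (simp add: Z_def)
    then show "j = k"
      using inj_onD[OF inj_on_residue_class[OF assms(1,4,9)]] jk by (simp add: A_def)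
  qed
  have card: "card (residue_codes p m r \<theta>) = m"
    using inj by (simp add: codes card_image)
  have nonempty: "residue_codes p m r \<theta> \<noteq> {}"
    using assms(3) card by auto
  have all_LCD: "LCD_code p C \<longleftrightarrow> even e" if "C \<in> residue_codes p m r \<theta>" for C
    using that LCD by (auto simp: codes)
  have all_so: "self_orthogonal_code p C \<longleftrightarrow> odd e" if "C \<in> residue_codes p m r \<theta>" for C
    using that so by (auto simp: codes)
  have "[p = 1] (mod 2 * m) \<longleftrightarrow> even e"
    unfolding pe by (rule cong_one_mod_double_iff_even) (use assms(3) in simp)
  moreover have "[p = m + 1] (mod 2 * m) \<longleftrightarrow> odd e"
    unfolding pe by (rule cong_add_one_mod_double_iff_odd) (use assms(3) in simp)
  \<comment> \<open>Either all residue codes have the property or none has, whence the counts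
    \<open>m\<close> and 0.\<close>
  moreover have "{C \<in> residue_codes p m r \<theta>. LCD_code p C}
      = (if even e then residue_codes p m r \<theta> else {})"
    using all_LCD by auto
  moreover have "{C \<in> residue_codes p m r \<theta>. self_orthogonal_code p C}
      = (if odd e then residue_codes p m r \<theta> else {})"
    using all_so by auto
  ultimately show ?thesis
    using all_LCD all_so nonempty card by auto
qed

end
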